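(* Let $c$ be a non-negative integer and let $G$ be a (nilpotent of class $c$)-by-abelian group. Suppose that the abelianization $G/G'$ is either finite or infinite non-periodic (this is the case for example when $G$ is finitely generated). Then the group $\mathrm{Aut_n}(G)$ of all normal automorphisms of $G$ is virtually (nilpotent of class $\leq c$)-by-abelian; that is, $\mathrm{Aut_n}(G)$ has a subgroup $K$ of finite index which has a normal subgroup $N$ such that $N$ is nilpotent of class at most $c$ and $K/N$ is abelian.
   Context: An automorphism $\varphi$ of a group $G$ is called normal if $\varphi(H)=H$ for every normal subgroup $H$ of $G$. The normal automorphisms of $G$ form a normal subgroup $\mathrm{Aut_n}(G)$ of the automorphism group $\mathrm{Aut}(G)$. For group properties $\mathcal{P}$ and $\mathcal{Q}$, a group is $\mathcal{P}$-by-$\mathcal{Q}$ if it has a normal subgroup with property $\mathcal{P}$ whose quotient has property $\mathcal{Q}$. $G'$ denotes the derived subgroup of $G$. A group is non-periodic if it has at least one element of infinite order. *)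

theory Defs
  imports "HOL-Algebra.Algebra"
begin

primrec lower_central :: "('a, 'b) monoid_scheme \<Rightarrow> nat \<Rightarrow> 'a set" where
  "lower_central G 0 = carrier G"
| "lower_central G (Suc n) =
     generate G (\<Union>x \<in> lower_central G n. \<Union>y \<in> carrier G.
       {x \<otimes>\<^bsub>G\<^esub> y \<otimes>\<^bsub>G\<^esub> inv\<^bsub>G\<^esub> x \<otimes>\<^bsub>G\<^esub> inv\<^bsub>G\<^esub> y})"

definition nilpotent_group :: "('a, 'b) monoid_scheme \<Rightarrow> bool" where
  "nilpotent_group G \<longleftrightarrow> group G \<and> (\<exists>n. lower_central G n = {\<one>\<^bsub>G\<^esub>})"

text \<open>Since the series starts with \<open>G\<close> at index \<open>0\<close>, the trivial group has class \<open>0\<close> and the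
  nontrivial abelian groups have class \<open>1\<close>. The value is meaningful for nilpotent groups only.\<close>

definition nilpotency_class :: "('a, 'b) monoid_scheme \<Rightarrow> nat" where
  "nilpotency_class G = (LEAST n. lower_central G n = {\<one>\<^bsub>G\<^esub>})"

definition nilpotent_of_class :: "nat \<Rightarrow> ('a, 'b) monoid_scheme \<Rightarrow> bool" where
  "nilpotent_of_class c G \<longleftrightarrow> nilpotent_group G \<and> nilpotency_class G = c"

definition nilpotent_of_class_le :: "nat \<Rightarrow> ('a, 'b) monoid_scheme \<Rightarrow> bool" where
  "nilpotent_of_class_le c G \<longleftrightarrow> nilpotent_group G \<and> nilpotency_class G \<le> c"

definition group_by_group ::
    "('a monoid \<Rightarrow> bool) \<Rightarrow> ('a set monoid \<Rightarrow> bool) \<Rightarrow> 'a monoid \<Rightarrow> bool" where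
  "group_by_group P Q G \<longleftrightarrow>
     (\<exists>N. N \<lhd> G \<and> P (G\<lparr>carrier := N\<rparr>) \<and> Q (G Mod N))"

text \<open>Finiteness of the index is stated as finiteness of the set of cosets, because
  \<open>card\<close> is \<open>0\<close> on infinite sets.\<close>

definition virtually :: "('a monoid \<Rightarrow> bool) \<Rightarrow> 'a monoid \<Rightarrow> bool" where
  "virtually P G \<longleftrightarrow>
     (\<exists>K. subgroup K G \<and> finite (rcosets\<^bsub>G\<^esub> K) \<and> P (G\<lparr>carrier := K\<rparr>))"

definition abelianization :: "('a, 'b) monoid_scheme \<Rightarrow> 'a set monoid" where
  "abelianization G = G Mod (derived G (carrier G))"

text \<open>\<open>group.ord\<close> takes the value \<open>0\<close> exactly on the elements of infinite order.\<close>

definition non_periodic :: "('a, 'b) monoid_scheme \<Rightarrow> bool" where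
  "non_periodic G \<longleftrightarrow> (\<exists>x \<in> carrier G. group.ord G x = 0)"

definition finitely_generated_group :: "('a, 'b) monoid_scheme \<Rightarrow> bool" where
  "finitely_generated_group G \<longleftrightarrow>
     (\<exists>S. finite S \<and> S \<subseteq> carrier G \<and> generate G S = carrier G)"

definition normal_autos :: "('a, 'b) monoid_scheme \<Rightarrow> ('a \<Rightarrow> 'a) set" where
  "normal_autos G = {\<phi> \<in> auto G. \<forall>H. H \<lhd> G \<longrightarrow> \<phi> ` H = H}"

definition NormalAutoGroup :: "('a, 'b) monoid_scheme \<Rightarrow> ('a \<Rightarrow> 'a) monoid" where
  "NormalAutoGroup G = AutoGroup G\<lparr>carrier := normal_autos G\<rparr>"

lemma AutoGroup_simps:
  "carrier (AutoGroup G) = auto G"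
  "\<one>\<^bsub>AutoGroup G\<^esub> = (\<lambda>x\<in>carrier G. x)"
  "\<phi> \<in> auto G \<Longrightarrow> \<psi> \<in> auto G \<Longrightarrow> \<phi> \<otimes>\<^bsub>AutoGroup G\<^esub> \<psi> = compose (carrier G) \<phi> \<psi>"
  by (auto simp: AutoGroup_def BijGroup_def auto_def)

lemma (in group) inv_AutoGroup:
  assumes "\<phi> \<in> auto G"
  shows "inv\<^bsub>AutoGroup G\<^esub> \<phi> = restrict (inv_into (carrier G) \<phi>) (carrier G)"
proof -
  have B: "\<phi> \<in> Bij (carrier G)" and h: "\<phi> \<in> hom G G" using assms by (auto simp: auto_def)
  have "restrict (inv_into (carrier G) \<phi>) (carrier G) \<in> auto G"
    using restrict_inv_into_hom[OF h B] restrict_inv_into_Bij[OF B] by (simp add: auto_def)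
  then show ?thesis
    using assms Bij_compose_restrict_eq[OF B]
    by (intro group.inv_equality[OF AutoGroup]) (simp_all add: AutoGroup_simps)
qed

lemma image_compose_on: "H \<subseteq> S \<Longrightarrow> compose S f g ` H = f ` g ` H"
  by (force simp: compose_def image_iff)

lemma (in group) auto_image_normal:
  assumes "\<phi> \<in> auto G" "H \<lhd> G"
  shows "\<phi> ` H \<lhd> G"
proof -
  have h: "\<phi> \<in> hom G G" and s: "\<phi> ` carrier G = carrier G"
    using assms(1) by (auto simp: auto_def Bij_def bij_betw_def)
  interpret group_hom G G \<phi> by unfold_locales (fact h)
  interpret H: normal H G by (fact assms(2))
  show ?thesis
  proof (rule normal_invI)
    show "subgroup (\<phi> ` H) G" by (rule subgroup_img_is_subgroup[OF H.subgroup_axioms])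
    fix x k assume x: "x \<in> carrier G" and k: "k \<in> \<phi> ` H"
    obtain y where y: "y \<in> carrier G" "x = \<phi> y" using x s by blast
    obtain m where m: "m \<in> H" "k = \<phi> m" using k by blast
    have mc: "m \<in> carrier G" using m(1) by (rule H.mem_carrier)
    have "x \<otimes> k \<otimes> inv x = \<phi> (y \<otimes> m \<otimes> inv y)"
      using y m mc by simp
    moreover have "y \<otimes> m \<otimes> inv y \<in> H" using y(1) m(1) by (rule H.inv_op_closed2)
    ultimately show "x \<otimes> k \<otimes> inv x \<in> \<phi> ` H" by simp
  qed
qed

lemma (in group) normal_autos_normal: "normal_autos G \<lhd> AutoGroup G"
proof -
  interpret A: group "AutoGroup G" by (rule AutoGroup)
  have inv_image: "(inv\<^bsub>AutoGroup G\<^esub> \<phi>) ` \<phi> ` H = H"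
    and image_inv: "\<phi> ` (inv\<^bsub>AutoGroup G\<^esub> \<phi>) ` H = H"
    if "\<phi> \<in> auto G" "H \<subseteq> carrier G" for \<phi> H
  proof -
    have i: "inv\<^bsub>AutoGroup G\<^esub> \<phi> \<in> auto G" using that A.inv_closed by (simp add: AutoGroup_simps)
    have one: "(\<lambda>x\<in>carrier G. x) ` H = H" using that(2) by force
    have "compose (carrier G) (inv\<^bsub>AutoGroup G\<^esub> \<phi>) \<phi> = (\<lambda>x\<in>carrier G. x)"
      and "compose (carrier G) \<phi> (inv\<^bsub>AutoGroup G\<^esub> \<phi>) = (\<lambda>x\<in>carrier G. x)"
      using A.l_inv[of \<phi>] A.r_inv[of \<phi>] that(1) i by (simp_all add: AutoGroup_simps)
    with one show "(inv\<^bsub>AutoGroup G\<^esub> \<phi>) ` \<phi> ` H = H" "\<phi> ` (inv\<^bsub>AutoGroup G\<^esub> \<phi>) ` H = H"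
      using image_compose_on[OF that(2), of "inv\<^bsub>AutoGroup G\<^esub> \<phi>" \<phi>]
        image_compose_on[OF that(2), of \<phi> "inv\<^bsub>AutoGroup G\<^esub> \<phi>"] by simp_all
  qed
  have sub: "H \<subseteq> carrier G" if "H \<lhd> G" for H
    using that by (simp add: normal_imp_subgroup subgroup.subset)
  show ?thesis
  proof (rule A.normal_invI)
    show "subgroup (normal_autos G) (AutoGroup G)"
    proof (rule A.subgroupI)
      show "normal_autos G \<subseteq> carrier (AutoGroup G)"
        by (auto simp: normal_autos_def AutoGroup_simps)
      have "(\<lambda>x\<in>carrier G. x) \<in> normal_autos G"
        using sub id_in_auto by (force simp: normal_autos_def)
      then show "normal_autos G \<noteq> {}" by blast
    next
      fix \<phi> assume p: "\<phi> \<in> normal_autos G"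
      then have pa: "\<phi> \<in> auto G" by (simp add: normal_autos_def)
      have "(inv\<^bsub>AutoGroup G\<^esub> \<phi>) ` H = H" if "H \<lhd> G" for H
        using inv_image[OF pa sub[OF that]] p that by (simp add: normal_autos_def)
      then show "inv\<^bsub>AutoGroup G\<^esub> \<phi> \<in> normal_autos G"
        using A.inv_closed[of \<phi>] pa by (simp add: normal_autos_def AutoGroup_simps)
    next
      fix \<phi> \<psi> assume p: "\<phi> \<in> normal_autos G" "\<psi> \<in> normal_autos G"
      then show "\<phi> \<otimes>\<^bsub>AutoGroup G\<^esub> \<psi> \<in> normal_autos G"
        using A.m_closed[of \<phi> \<psi>]
        by (auto simp: normal_autos_def AutoGroup_simps image_compose_on sub)
    qed
  next
    fix \<alpha> \<phi> assume a: "\<alpha> \<in> carrier (AutoGroup G)" and p: "\<phi> \<in> normal_autos G"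
    let ?i = "inv\<^bsub>AutoGroup G\<^esub> \<alpha>"
    have aa: "\<alpha> \<in> auto G" and pa: "\<phi> \<in> auto G" and ia: "?i \<in> auto G"
      and apa: "\<alpha> \<otimes>\<^bsub>AutoGroup G\<^esub> \<phi> \<in> auto G"
      and apia: "\<alpha> \<otimes>\<^bsub>AutoGroup G\<^esub> \<phi> \<otimes>\<^bsub>AutoGroup G\<^esub> ?i \<in> auto G"
      using a p A.inv_closed[of \<alpha>] A.m_closed[of \<alpha> \<phi>]
        A.m_closed[of "\<alpha> \<otimes>\<^bsub>AutoGroup G\<^esub> \<phi>" ?i]
      by (simp_all add: normal_autos_def AutoGroup_simps(1))
    have "(\<alpha> \<otimes>\<^bsub>AutoGroup G\<^esub> \<phi> \<otimes>\<^bsub>AutoGroup G\<^esub> ?i) ` H = H" if H: "H \<lhd> G" for H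
    proof -
      have iH: "?i ` H \<lhd> G" by (rule auto_image_normal[OF ia H])
      have "(\<alpha> \<otimes>\<^bsub>AutoGroup G\<^esub> \<phi> \<otimes>\<^bsub>AutoGroup G\<^esub> ?i) ` H = \<alpha> ` \<phi> ` ?i ` H"
        using AutoGroup_simps(3)[OF apa ia] AutoGroup_simps(3)[OF aa pa]
        by (simp add: image_compose_on[OF sub[OF H]] image_compose_on[OF sub[OF iH]])
      also have "\<phi> ` ?i ` H = ?i ` H" using p iH by (simp add: normal_autos_def)
      also have "\<alpha> ` ?i ` H = H" by (rule image_inv[OF aa sub[OF H]])
      finally show ?thesis .
    qed
    then show "\<alpha> \<otimes>\<^bsub>AutoGroup G\<^esub> \<phi> \<otimes>\<^bsub>AutoGroup G\<^esub> ?i \<in> normal_autos G"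
      using apia by (simp add: normal_autos_def)
  qed
qed

lemma (in group) group_NormalAutoGroup: "group (NormalAutoGroup G)"
  unfolding NormalAutoGroup_def
  by (rule subgroup.subgroup_is_group[OF normal_imp_subgroup[OF normal_autos_normal] AutoGroup])

end

theory Submission
  imports Defs
begin

text \<open>
  Let \<open>M\<close> be normal in \<open>G\<close>, nilpotent of class \<open>c\<close>, with \<open>G/M\<close> abelian. The finite-index subgroup
  \<open>K\<close> consists of the normal automorphisms that act trivially on \<open>G/M\<close>.

  \<^item> \<open>K\<close> has finite index because \<open>G/M\<close> is a quotient of \<open>G/G'\<close>, and only finitely many actions on
    \<open>G/G'\<close> come from normal automorphisms. This is clear if \<open>G/G'\<close> is finite. In general a normal
    automorphism maps every element of \<open>G/G'\<close> to a power of itself, and if \<open>G/G'\<close> has an element of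
    infinite order this forces the action to be the identity or inversion
    (\<open>power_automorphism_cases\<close>, \<open>finite_index_trivial_action\<close>).

  \<^item> Consider the series \<open>G \<ge> M = \<gamma>\<^sub>1(M) \<ge> \<gamma>\<^sub>2(M) \<ge> \<dots> \<ge> \<gamma>\<^sub>c\<^sub>+\<^sub>1(M) = 1\<close> and the group \<open>N\<close> of
    those normal automorphisms that act trivially on all its factors. Each factor
    \<open>\<gamma>\<^sub>i(M)/\<gamma>\<^sub>i\<^sub>+\<^sub>1(M)\<close> is a module over the commutative group ring of \<open>G/M\<close>. The elements of \<open>K\<close>
    act by module endomorphisms, and since they fix normal closures, each of them sends a
    given \<open>u\<close> to \<open>r u\<close> for some \<open>r\<close> in the group ring. If \<open>\<phi> u = r u\<close> and \<open>\<psi> u = s u\<close>, then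
    \<open>\<phi> (\<psi> u) = s r u = r s u = \<psi> (\<phi> u)\<close>. Hence \<open>K' \<le> N\<close>, that is, \<open>K/N\<close> is abelian
    (\<open>normal_autos_commute_on_section\<close>, \<open>commutator_in_stability\<close>).

  \<^item> \<open>N\<close> stabilizes a series with \<open>c + 1\<close> factors, so it is nilpotent of class at most \<open>c\<close>, as in the
    theorem of Kaluzhnin. The filtration behind this consists of the subgroups of automorphisms
    that move the \<open>j\<close>-th term only by elements of the \<open>(j + n + 1)\<close>-st term. Commuting with \<open>N\<close>
    raises \<open>n\<close> by one (\<open>stability_commutator\<close>), and the level \<open>n = c\<close> is trivial.

  If \<open>G\<close> is finitely generated and \<open>G/G'\<close> is periodic, then \<open>G/G'\<close> is a product of finitely many
  finite cyclic groups, hence finite.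
\<close>

section \<open>Normal automorphisms\<close>

lemma (in group) inv_mult_cancel:
  "\<lbrakk>x \<in> carrier G; y \<in> carrier G\<rbrakk> \<Longrightarrow> inv x \<otimes> (x \<otimes> y) = y"
  by (simp flip: m_assoc)

lemma (in group) normal_autos_hom:
  assumes "\<phi> \<in> normal_autos G"
  shows "group_hom G G \<phi>"
  using assms by unfold_locales (auto simp: normal_autos_def auto_def)

lemma normal_autos_image: "\<lbrakk>\<phi> \<in> normal_autos G; H \<lhd> G\<rbrakk> \<Longrightarrow> \<phi> ` H = H"
  by (simp add: normal_autos_def)

lemma normal_autos_mem: "\<lbrakk>\<phi> \<in> normal_autos G; H \<lhd> G; x \<in> H\<rbrakk> \<Longrightarrow> \<phi> x \<in> H"
  using normal_autos_image by blast

lemma carrier_NormalAutoGroup [simp]: "carrier (NormalAutoGroup G) = normal_autos G"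
  by (simp add: NormalAutoGroup_def)

lemma (in group) NormalAutoGroup_mult_apply:
  assumes "\<phi> \<in> normal_autos G" "\<psi> \<in> normal_autos G" "x \<in> carrier G"
  shows "(\<phi> \<otimes>\<^bsub>NormalAutoGroup G\<^esub> \<psi>) x = \<phi> (\<psi> x)"
  using assms by (simp add: NormalAutoGroup_def normal_autos_def AutoGroup_simps compose_def)

lemma NormalAutoGroup_one_apply:
  "x \<in> carrier G \<Longrightarrow> \<one>\<^bsub>NormalAutoGroup G\<^esub> x = x"
  by (simp add: NormalAutoGroup_def AutoGroup_simps)

lemma (in group) NormalAutoGroup_inv_closed:
  "\<phi> \<in> normal_autos G \<Longrightarrow> inv\<^bsub>NormalAutoGroup G\<^esub> \<phi> \<in> normal_autos G"
  using group.inv_closed[OF group_NormalAutoGroup] by simp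

lemma (in group) NormalAutoGroup_inv_apply:
  assumes "\<phi> \<in> normal_autos G" "x \<in> carrier G"
  shows "\<phi> ((inv\<^bsub>NormalAutoGroup G\<^esub> \<phi>) x) = x" "(inv\<^bsub>NormalAutoGroup G\<^esub> \<phi>) (\<phi> x) = x"
proof -
  interpret N: group "NormalAutoGroup G" by (rule group_NormalAutoGroup)
  show "\<phi> ((inv\<^bsub>NormalAutoGroup G\<^esub> \<phi>) x) = x"
    using NormalAutoGroup_mult_apply[OF assms(1) NormalAutoGroup_inv_closed[OF assms(1)] assms(2)]
      N.r_inv[of \<phi>] assms by (simp add: NormalAutoGroup_one_apply)
  show "(inv\<^bsub>NormalAutoGroup G\<^esub> \<phi>) (\<phi> x) = x"
    using NormalAutoGroup_mult_apply[OF NormalAutoGroup_inv_closed[OF assms(1)] assms(1) assms(2)]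
      N.l_inv[of \<phi>] assms by (simp add: NormalAutoGroup_one_apply)
qed

lemma (in group) normal_autos_image_rcos:
  assumes "\<phi> \<in> normal_autos G" "T \<lhd> G" "x \<in> carrier G"
  shows "\<phi> ` (T #> x) = T #> \<phi> x"
proof -
  interpret \<phi>: group_hom G G \<phi> by (rule normal_autos_hom[OF assms(1)])
  have T: "T \<subseteq> carrier G" using assms(2) by (simp add: normal_imp_subgroup subgroup.subset)
  have "\<phi> ` (T #> x) = (\<lambda>t. \<phi> t \<otimes> \<phi> x) ` T"
    using T assms(3) by (force simp: r_coset_def)
  also have "\<dots> = \<phi> ` T #> \<phi> x" by (force simp: r_coset_def)
  finally show ?thesis using normal_autos_image[OF assms(1,2)] by simp
qed

lemma (in group) normal_autos_cong:
  assumes "\<phi> \<in> normal_autos G" "T \<lhd> G" "x \<in> carrier G" "y \<in> carrier G" "T #> x = T #> y"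
  shows "T #> \<phi> x = T #> \<phi> y"
  using assms normal_autos_image_rcos by metis

lemma (in group) rcos_eq_cases:
  assumes "subgroup T G" "x \<in> carrier G" "y \<in> carrier G" "T #> y = T #> x"
  obtains t where "t \<in> T" "y = t \<otimes> x"
proof -
  have "y \<in> T #> x" using rcos_self[OF assms(3,1)] assms(4) by simp
  then show thesis using that by (auto simp: r_coset_def)
qed

lemma (in normal) r_coset_group_hom: "group_hom G (G Mod H) (\<lambda>a. H #> a)"
  by (intro group_hom.intro group_hom_axioms.intro r_coset_hom_Mod factorgroup_is_group is_group)

text \<open>For consecutive terms \<open>S\<close> and \<open>T\<close> of a normal series this means a trivial action on a factor; for
  terms further apart it yields the deeper levels of the filtration of the stability group.\<close>

definition trivial_action :: "('a, 'b) monoid_scheme \<Rightarrow> 'a set \<Rightarrow> 'a set \<Rightarrow> ('a \<Rightarrow> 'a) set" where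
  "trivial_action G S T = {\<phi> \<in> normal_autos G. \<forall>g\<in>S. T #>\<^bsub>G\<^esub> \<phi> g = T #>\<^bsub>G\<^esub> g}"

lemma trivial_actionD:
  assumes "\<phi> \<in> trivial_action G S T"
  shows "\<phi> \<in> normal_autos G" "g \<in> S \<Longrightarrow> T #>\<^bsub>G\<^esub> \<phi> g = T #>\<^bsub>G\<^esub> g"
  using assms by (auto simp: trivial_action_def)

lemma (in group) trivial_action_normal:
  assumes S: "S \<lhd> G" and T: "T \<lhd> G"
  shows "trivial_action G S T \<lhd> NormalAutoGroup G"
proof -
  interpret A: group "NormalAutoGroup G" by (rule group_NormalAutoGroup)
  have SG: "x \<in> carrier G" if "x \<in> S" for x
    using that S by (meson normal_imp_subgroup subgroup.mem_carrier)
  note [simp] = NormalAutoGroup_inv_closed NormalAutoGroup_mult_apply NormalAutoGroup_inv_apply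
  have clo: "\<phi> x \<in> S" "\<phi> x \<in> carrier G" if "\<phi> \<in> normal_autos G" "x \<in> S" for \<phi> x
    using normal_autos_mem[OF that(1) S that(2)] SG by auto
  show ?thesis
  proof (rule A.normal_invI)
    show "subgroup (trivial_action G S T) (NormalAutoGroup G)"
    proof (rule A.subgroupI)
      show "trivial_action G S T \<subseteq> carrier (NormalAutoGroup G)"
        by (auto simp: trivial_action_def)
      have "\<one>\<^bsub>NormalAutoGroup G\<^esub> \<in> trivial_action G S T"
        using A.one_closed SG by (simp add: trivial_action_def NormalAutoGroup_one_apply)
      then show "trivial_action G S T \<noteq> {}" by blast
    next
      fix \<phi> assume p: "\<phi> \<in> trivial_action G S T"
      note pn = trivial_actionD(1)[OF p]
      have "T #> (inv\<^bsub>NormalAutoGroup G\<^esub> \<phi>) g = T #> g" if g: "g \<in> S" for g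
        using trivial_actionD(2)[OF p clo(1)[OF NormalAutoGroup_inv_closed[OF pn] g]] pn SG[OF g]
        by simp
      then show "inv\<^bsub>NormalAutoGroup G\<^esub> \<phi> \<in> trivial_action G S T"
        using pn by (simp add: trivial_action_def)
    next
      fix \<phi> \<psi> assume p: "\<phi> \<in> trivial_action G S T" and q: "\<psi> \<in> trivial_action G S T"
      note pn = trivial_actionD(1)[OF p] and qn = trivial_actionD(1)[OF q]
      have "T #> \<phi> (\<psi> g) = T #> g" if g: "g \<in> S" for g
        using trivial_actionD(2)[OF p clo(1)[OF qn g]] trivial_actionD(2)[OF q g] by simp
      then show "\<phi> \<otimes>\<^bsub>NormalAutoGroup G\<^esub> \<psi> \<in> trivial_action G S T"
        using pn qn A.m_closed[of \<phi> \<psi>] SG by (simp add: trivial_action_def)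
    qed
  next
    fix \<alpha> \<phi> assume "\<alpha> \<in> carrier (NormalAutoGroup G)" and p: "\<phi> \<in> trivial_action G S T"
    then have an: "\<alpha> \<in> normal_autos G" by simp
    note pn = trivial_actionD(1)[OF p]
    let ?i = "inv\<^bsub>NormalAutoGroup G\<^esub> \<alpha>"
    have "T #> \<alpha> (\<phi> (?i g)) = T #> g" if g: "g \<in> S" for g
    proof -
      have i: "?i g \<in> S" by (rule clo(1)[OF NormalAutoGroup_inv_closed[OF an] g])
      have "T #> \<alpha> (\<phi> (?i g)) = T #> \<alpha> (?i g)"
        by (rule normal_autos_cong[OF an T clo(2)[OF pn i] SG[OF i] trivial_actionD(2)[OF p i]])
      then show ?thesis using an SG[OF g] by simp
    qed
    then show "\<alpha> \<otimes>\<^bsub>NormalAutoGroup G\<^esub> \<phi> \<otimes>\<^bsub>NormalAutoGroup G\<^esub> ?i \<in> trivial_action G S T"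
      using an pn A.m_closed[of \<alpha> \<phi>] A.m_closed[of "\<alpha> \<otimes>\<^bsub>NormalAutoGroup G\<^esub> \<phi>" ?i] SG
        clo(2)[OF NormalAutoGroup_inv_closed[OF an]]
      by (simp add: trivial_action_def)
  qed
qed

text \<open>Substituting \<open>g = \<psi> (\<phi> h)\<close> turns a statement about the commutator at \<open>g\<close> into a comparison of
  \<open>\<phi> (\<psi> h)\<close> and \<open>\<psi> (\<phi> h)\<close>; \<open>h\<close> stays in \<open>S\<close> because \<open>S\<close> is normal.\<close>

lemma (in group) commutator_trivial_action:
  assumes p: "\<phi> \<in> normal_autos G" and q: "\<psi> \<in> normal_autos G" and S: "S \<lhd> G"
    and comm: "\<And>g. g \<in> S \<Longrightarrow> T #> \<phi> (\<psi> g) = T #> \<psi> (\<phi> g)"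
  shows "\<phi> \<otimes>\<^bsub>NormalAutoGroup G\<^esub> \<psi> \<otimes>\<^bsub>NormalAutoGroup G\<^esub> inv\<^bsub>NormalAutoGroup G\<^esub> \<phi>
           \<otimes>\<^bsub>NormalAutoGroup G\<^esub> inv\<^bsub>NormalAutoGroup G\<^esub> \<psi> \<in> trivial_action G S T"
    (is "?c \<in> _")
proof -
  interpret A: group "NormalAutoGroup G" by (rule group_NormalAutoGroup)
  let ?i = "inv\<^bsub>NormalAutoGroup G\<^esub> \<phi>" and ?j = "inv\<^bsub>NormalAutoGroup G\<^esub> \<psi>"
  have i: "?i \<in> normal_autos G" and j: "?j \<in> normal_autos G"
    using p q by (simp_all add: NormalAutoGroup_inv_closed)
  have pq: "\<phi> \<otimes>\<^bsub>NormalAutoGroup G\<^esub> \<psi> \<in> normal_autos G"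
    using A.m_closed[of \<phi> \<psi>] p q by simp
  have pqi: "\<phi> \<otimes>\<^bsub>NormalAutoGroup G\<^esub> \<psi> \<otimes>\<^bsub>NormalAutoGroup G\<^esub> ?i \<in> normal_autos G"
    using A.m_closed[of _ ?i] pq i by simp
  have c: "?c \<in> normal_autos G"
    using A.m_closed[of _ ?j] pqi j by simp
  have "T #> ?c g = T #> g" if g: "g \<in> S" for g
  proof -
    have jg: "?j g \<in> S" by (rule normal_autos_mem[OF j S g])
    have ijg: "?i (?j g) \<in> S" by (rule normal_autos_mem[OF i S jg])
    have carr: "g \<in> carrier G" "?j g \<in> carrier G" "?i (?j g) \<in> carrier G"
      using g jg ijg S by (meson normal_imp_subgroup subgroup.mem_carrier)+
    have "?c g = \<phi> (\<psi> (?i (?j g)))"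
      using carr p q i j pq pqi by (simp add: NormalAutoGroup_mult_apply)
    then have "T #> ?c g = T #> \<psi> (\<phi> (?i (?j g)))" using comm[OF ijg] by simp
    then show ?thesis using carr p q by (simp add: NormalAutoGroup_inv_apply)
  qed
  then show ?thesis using c by (simp add: trivial_action_def)
qed

section \<open>Stability\<close>

text \<open>Write \<open>\<alpha> g = t g\<close> and \<open>\<beta> g = u g\<close> with \<open>t \<in> T\<close> and \<open>u \<in> U\<close>. Modulo \<open>W\<close> the map \<open>\<alpha>\<close> fixes \<open>u\<close> and
  \<open>\<beta>\<close> fixes \<open>t\<close>, so the two composites send \<open>g\<close> to \<open>u t g\<close> and \<open>t u g\<close>, which agree because \<open>t\<close> and
  \<open>u\<close> commute modulo \<open>W\<close>. This direct computation takes the place of the three subgroup lemma in the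
  usual proof of Kaluzhnin's theorem.\<close>

lemma (in group) trivial_action_commute:
  assumes T: "T \<lhd> G" and U: "U \<lhd> G" and W: "W \<lhd> G"
    and TU: "\<And>t u. \<lbrakk>t \<in> T; u \<in> U\<rbrakk> \<Longrightarrow> W #> (t \<otimes> u) = W #> (u \<otimes> t)"
    and a: "\<alpha> \<in> trivial_action G S T" "\<alpha> \<in> trivial_action G U W"
    and b: "\<beta> \<in> trivial_action G S U" "\<beta> \<in> trivial_action G T W"
    and g: "g \<in> S" "g \<in> carrier G"
  shows "W #> \<alpha> (\<beta> g) = W #> \<beta> (\<alpha> g)"
proof -
  interpret \<alpha>: group_hom G G \<alpha> by (rule normal_autos_hom[OF trivial_actionD(1)[OF a(1)]])
  interpret \<beta>: group_hom G G \<beta> by (rule normal_autos_hom[OF trivial_actionD(1)[OF b(1)]])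
  interpret W: normal W G by (rule W)
  interpret p: group_hom G "G Mod W" "\<lambda>a. W #> a" by (rule W.r_coset_group_hom)
  obtain t where t: "t \<in> T" "\<alpha> g = t \<otimes> g"
    using rcos_eq_cases[OF normal_imp_subgroup[OF T] g(2) _ trivial_actionD(2)[OF a(1) g(1)]] g(2)
    by auto
  obtain u where u: "u \<in> U" "\<beta> g = u \<otimes> g"
    using rcos_eq_cases[OF normal_imp_subgroup[OF U] g(2) _ trivial_actionD(2)[OF b(1) g(1)]] g(2)
    by auto
  have tc: "t \<in> carrier G" and uc: "u \<in> carrier G"
    using t u T U by (meson normal_imp_subgroup subgroup.mem_carrier)+
  have "W #> \<alpha> (\<beta> g) = W #> (\<alpha> u \<otimes> (t \<otimes> g))"
    using u t uc g by simp
  also have "\<dots> = W #> (u \<otimes> (t \<otimes> g))"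
    using trivial_actionD(2)[OF a(2) u(1)] uc tc g(2) p.hom_mult[of "\<alpha> u" "t \<otimes> g"]
      p.hom_mult[of u "t \<otimes> g"] \<alpha>.hom_closed[OF uc] by simp
  also have "\<dots> = W #> (t \<otimes> (u \<otimes> g))"
    using TU[OF t(1) u(1)] uc tc g(2) p.hom_mult[of "t \<otimes> u" g] p.hom_mult[of "u \<otimes> t" g]
    by (simp add: m_assoc)
  also have "\<dots> = W #> (\<beta> t \<otimes> (u \<otimes> g))"
    using trivial_actionD(2)[OF b(2) t(1)] uc tc g(2) p.hom_mult[of "\<beta> t" "u \<otimes> g"]
      p.hom_mult[of t "u \<otimes> g"] \<beta>.hom_closed[OF tc] by simp
  also have "\<dots> = W #> \<beta> (\<alpha> g)"
    using u t tc g by simp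
  finally show ?thesis .
qed

section \<open>Commutation on abelian sections\<close>

text \<open>These words stand for the elements of the integral group ring of \<open>G\<close>, in multiplicative
  notation: a word acts on a normal subgroup \<open>V\<close>, and on an abelian section \<open>V/W\<close> it acts like an
  element \<open>\<Sum> n\<^sub>i g\<^sub>i\<close> of the group ring acts on a module. Working with actual functions on \<open>G\<close>
  avoids constructing the ring and the module.\<close>

inductive_set conj_words :: "('a, 'b) monoid_scheme \<Rightarrow> ('a \<Rightarrow> 'a) set" for G (structure) where
  ident: "(\<lambda>x. x) \<in> conj_words G"
| conj: "\<lbrakk>\<rho> \<in> conj_words G; g \<in> carrier G\<rbrakk> \<Longrightarrow> (\<lambda>x. g \<otimes> \<rho> x \<otimes> inv g) \<in> conj_words G"
| prod: "\<lbrakk>\<rho> \<in> conj_words G; \<sigma> \<in> conj_words G\<rbrakk> \<Longrightarrow> (\<lambda>x. \<rho> x \<otimes> \<sigma> x) \<in> conj_words G"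
| inverse: "\<rho> \<in> conj_words G \<Longrightarrow> (\<lambda>x. inv \<rho> x) \<in> conj_words G"

lemma (in group) conj_words_closed:
  assumes "\<rho> \<in> conj_words G" "V \<lhd> G" "x \<in> V"
  shows "\<rho> x \<in> V"
proof -
  interpret V: normal V G by (rule assms)
  show ?thesis using assms(1,3) by induction (auto simp: V.inv_op_closed2)
qed

lemma (in group) conj_words_orbit_normal:
  assumes u: "u \<in> carrier G"
  shows "(\<lambda>\<rho>. \<rho> u) ` conj_words G \<lhd> G"
proof (rule normal_invI)
  show "subgroup ((\<lambda>\<rho>. \<rho> u) ` conj_words G) G"
  proof (rule subgroupI)
    show "(\<lambda>\<rho>. \<rho> u) ` conj_words G \<subseteq> carrier G"
      using conj_words_closed[OF _ normal_self u] by blast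
    show "(\<lambda>\<rho>. \<rho> u) ` conj_words G \<noteq> {}" using conj_words.ident[of G] by blast
  qed (use conj_words.inverse[of _ G] conj_words.prod[of _ G] in fast)+
qed (use conj_words.conj[of _ G] in fast)

text \<open>The values of the words at \<open>u\<close> form the normal closure of \<open>u\<close>, and a normal automorphism
  leaves it invariant. The word \<open>\<rho>\<close> depends on \<open>u\<close>.\<close>

lemma (in group) normal_autos_conj_word:
  assumes "\<phi> \<in> normal_autos G" "u \<in> carrier G"
  obtains \<rho> where "\<rho> \<in> conj_words G" "\<phi> u = \<rho> u"
proof -
  have "u \<in> (\<lambda>\<rho>. \<rho> u) ` conj_words G" using conj_words.ident[of G] by force
  then have "\<phi> u \<in> (\<lambda>\<rho>. \<rho> u) ` conj_words G"
    by (rule normal_autos_mem[OF assms(1) conj_words_orbit_normal[OF assms(2)]])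
  then show thesis using that by blast
qed

text \<open>The endomorphisms of \<open>V/W\<close> as a module over the group ring of \<open>G\<close>, described by representing maps
  on \<open>V\<close>.\<close>

definition equivariant_mod ::
    "('a, 'b) monoid_scheme \<Rightarrow> 'a set \<Rightarrow> 'a set \<Rightarrow> ('a \<Rightarrow> 'a) \<Rightarrow> bool" where
  "equivariant_mod G V W \<theta> \<longleftrightarrow>
     (\<forall>x\<in>V. \<theta> x \<in> V)
   \<and> (\<forall>x\<in>V. \<forall>y\<in>V. W #>\<^bsub>G\<^esub> \<theta> (x \<otimes>\<^bsub>G\<^esub> y) = W #>\<^bsub>G\<^esub> (\<theta> x \<otimes>\<^bsub>G\<^esub> \<theta> y))
   \<and> (\<forall>g\<in>carrier G. \<forall>x\<in>V.
        W #>\<^bsub>G\<^esub> \<theta> (g \<otimes>\<^bsub>G\<^esub> x \<otimes>\<^bsub>G\<^esub> inv\<^bsub>G\<^esub> g) = W #>\<^bsub>G\<^esub> (g \<otimes>\<^bsub>G\<^esub> \<theta> x \<otimes>\<^bsub>G\<^esub> inv\<^bsub>G\<^esub> g))"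

lemma (in group) equivariant_conj_word:
  assumes V: "V \<lhd> G" and W: "W \<lhd> G" and \<theta>: "equivariant_mod G V W \<theta>"
    and "\<rho> \<in> conj_words G" and x: "x \<in> V"
  shows "W #> \<theta> (\<rho> x) = W #> \<rho> (\<theta> x)"
proof -
  interpret V: normal V G by (rule V)
  interpret W: normal W G by (rule W)
  interpret p: group_hom G "G Mod W" "\<lambda>a. W #> a" by (rule W.r_coset_group_hom)
  have mem: "\<And>x. x \<in> V \<Longrightarrow> \<theta> x \<in> V"
    and mult: "\<And>x y. \<lbrakk>x \<in> V; y \<in> V\<rbrakk> \<Longrightarrow> W #> \<theta> (x \<otimes> y) = W #> (\<theta> x \<otimes> \<theta> y)"
    and cj: "\<And>g x. \<lbrakk>g \<in> carrier G; x \<in> V\<rbrakk>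
      \<Longrightarrow> W #> \<theta> (g \<otimes> x \<otimes> inv g) = W #> (g \<otimes> \<theta> x \<otimes> inv g)"
    using \<theta> unfolding equivariant_mod_def by blast+
  have one: "W #> \<theta> \<one> = \<one>\<^bsub>G Mod W\<^esub>"
  proof -
    have c: "\<theta> \<one> \<in> carrier G" using mem[OF V.one_closed] by simp
    have "(W #> \<theta> \<one>) \<otimes>\<^bsub>G Mod W\<^esub> (W #> \<theta> \<one>) = W #> \<theta> \<one>"
      using mult[OF V.one_closed V.one_closed] p.hom_mult[OF c c] by simp
    then show ?thesis
      using p.H.l_cancel_one[OF p.hom_closed[OF c] p.hom_closed[OF c]] by blast
  qed
  have theta_inv: "W #> \<theta> (inv y) = W #> inv \<theta> y" if y: "y \<in> V" for y
  proof -
    have c: "\<theta> y \<in> carrier G" "\<theta> (inv y) \<in> carrier G" "y \<in> carrier G"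
      using mem[OF y] mem[OF V.m_inv_closed[OF y]] y by simp_all
    have "(W #> \<theta> (inv y)) \<otimes>\<^bsub>G Mod W\<^esub> (W #> \<theta> y) = \<one>\<^bsub>G Mod W\<^esub>"
      using mult[OF V.m_inv_closed[OF y] y] p.hom_mult[OF c(2,1)] one c(3) by simp
    then have "inv\<^bsub>G Mod W\<^esub> (W #> \<theta> y) = W #> \<theta> (inv y)"
      using p.H.inv_equality p.hom_closed[OF c(1)] p.hom_closed[OF c(2)] by blast
    then show ?thesis using p.hom_inv[OF c(1)] by simp
  qed
  have clo: "\<rho> y \<in> V" "\<rho> y \<in> carrier G" if "\<rho> \<in> conj_words G" "y \<in> V" for \<rho> y
    using conj_words_closed[OF that(1) V that(2)] by auto
  show ?thesis using assms(4)
  proof induction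
    case (conj \<rho> g)
    have c: "\<theta> (\<rho> x) \<in> carrier G" "\<rho> (\<theta> x) \<in> carrier G"
      by (rule V.mem_carrier[OF mem[OF clo(1)[OF conj.hyps(1) x]]],
          rule clo(2)[OF conj.hyps(1) mem[OF x]])
    show ?case
      using cj[OF conj.hyps(2) clo(1)[OF conj.hyps(1) x]] conj c by (simp del: mult_FactGroup)
  next
    case (prod \<rho> \<sigma>)
    have c: "\<theta> (\<rho> x) \<in> carrier G" "\<rho> (\<theta> x) \<in> carrier G"
        "\<theta> (\<sigma> x) \<in> carrier G" "\<sigma> (\<theta> x) \<in> carrier G"
      by (rule V.mem_carrier[OF mem[OF clo(1)[OF prod.hyps(1) x]]],
          rule clo(2)[OF prod.hyps(1) mem[OF x]],
          rule V.mem_carrier[OF mem[OF clo(1)[OF prod.hyps(2) x]]],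
          rule clo(2)[OF prod.hyps(2) mem[OF x]])
    show ?case
      using mult[OF clo(1)[OF prod.hyps(1) x] clo(1)[OF prod.hyps(2) x]] prod.IH c
      by (simp del: mult_FactGroup)
  next
    case (inverse \<rho>)
    have c: "\<theta> (\<rho> x) \<in> carrier G" "\<rho> (\<theta> x) \<in> carrier G"
      by (rule V.mem_carrier[OF mem[OF clo(1)[OF inverse.hyps x]]],
          rule clo(2)[OF inverse.hyps mem[OF x]])
    show ?case
      using theta_inv[OF clo(1)[OF inverse.hyps x]] inverse.IH c
      by simp
  qed simp
qed

text \<open>By \<open>cc\<close> the actions of any two elements of \<open>G\<close> on \<open>V/W\<close> commute, so the ring that acts on this
  abelian section is commutative. Therefore scalar multiplication is itself a module endomorphism.\<close>

lemma (in group) conj_word_equivariant: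
  assumes V: "V \<lhd> G" and W: "W \<lhd> G"
    and ab: "\<And>x y. \<lbrakk>x \<in> V; y \<in> V\<rbrakk> \<Longrightarrow> W #> (x \<otimes> y) = W #> (y \<otimes> x)"
    and cc: "\<And>g h v. \<lbrakk>g \<in> carrier G; h \<in> carrier G; v \<in> V\<rbrakk> \<Longrightarrow>
      W #> (g \<otimes> (h \<otimes> v \<otimes> inv h) \<otimes> inv g) = W #> (h \<otimes> (g \<otimes> v \<otimes> inv g) \<otimes> inv h)"
    and "\<rho> \<in> conj_words G"
  shows "equivariant_mod G V W \<rho>"
proof -
  interpret V: normal V G by (rule V)
  interpret W: normal W G by (rule W)
  interpret p: group_hom G "G Mod W" "\<lambda>a. W #> a" by (rule W.r_coset_group_hom)
  note [simp del] = mult_FactGroup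
  have clo: "\<rho> y \<in> V" "\<rho> y \<in> carrier G" if "\<rho> \<in> conj_words G" "y \<in> V" for \<rho> y
    using conj_words_closed[OF that(1) V that(2)] by auto
  have ab': "(W #> x) \<otimes>\<^bsub>G Mod W\<^esub> (W #> y) = (W #> y) \<otimes>\<^bsub>G Mod W\<^esub> (W #> x)"
    if "x \<in> V" "y \<in> V" for x y
    using ab[OF that] that by simp
  have "W #> \<rho> (x \<otimes> y) = W #> (\<rho> x \<otimes> \<rho> y)" if x: "x \<in> V" and y: "y \<in> V" for x y
    using assms(5)
  proof induction
    case (conj \<rho> g)
    have "W #> (g \<otimes> \<rho> (x \<otimes> y) \<otimes> inv g) = W #> (g \<otimes> (\<rho> x \<otimes> \<rho> y) \<otimes> inv g)"
      using conj clo x y by simp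
    also have "g \<otimes> (\<rho> x \<otimes> \<rho> y) \<otimes> inv g = (g \<otimes> \<rho> x \<otimes> inv g) \<otimes> (g \<otimes> \<rho> y \<otimes> inv g)"
      using conj.hyps clo x y by (simp add: m_assoc inv_mult_cancel)
    finally show ?case .
  next
    case (prod \<rho> \<sigma>)
    have c: "\<rho> x \<in> V" "\<rho> y \<in> V" "\<sigma> x \<in> V" "\<sigma> y \<in> V" "\<rho> (x \<otimes> y) \<in> V" "\<sigma> (x \<otimes> y) \<in> V"
      using clo prod.hyps x y by auto
    have d: "W #> \<rho> x \<in> carrier (G Mod W)" "W #> \<rho> y \<in> carrier (G Mod W)"
       "W #> \<sigma> x \<in> carrier (G Mod W)" "W #> \<sigma> y \<in> carrier (G Mod W)" using c by auto
    have "W #> (\<rho> (x \<otimes> y) \<otimes> \<sigma> (x \<otimes> y)) = W #> (\<rho> x \<otimes> \<rho> y \<otimes> (\<sigma> x \<otimes> \<sigma> y))"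
      using prod.IH c by simp
    also have "\<dots> = W #> (\<rho> x \<otimes> \<sigma> x \<otimes> (\<rho> y \<otimes> \<sigma> y))"
    proof -
      have "\<rho> x \<in> carrier G" "\<rho> y \<in> carrier G" "\<sigma> x \<in> carrier G" "\<sigma> y \<in> carrier G"
        using c by auto
      then show ?thesis using ab'[OF c(2,3)]
        by (simp add: p.H.m_assoc) (simp flip: p.H.m_assoc)
    qed
    finally show ?case .
  next
    case (inverse \<rho>)
    have c: "\<rho> x \<in> V" "\<rho> y \<in> V" "\<rho> (x \<otimes> y) \<in> V"
      using clo inverse.hyps x y by auto
    show ?case
      using inverse.IH c ab'[OF c(1,2)] by (simp add: p.H.inv_mult_group)
  qed simp
  moreover have "W #> \<rho> (g \<otimes> x \<otimes> inv g) = W #> (g \<otimes> \<rho> x \<otimes> inv g)"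
    if g: "g \<in> carrier G" and x: "x \<in> V" for g x
    using assms(5)
  proof induction
    case (conj \<rho> h)
    have gx: "g \<otimes> x \<otimes> inv g \<in> V" using V.inv_op_closed2 g x by blast
    have "W #> (h \<otimes> \<rho> (g \<otimes> x \<otimes> inv g) \<otimes> inv h) = W #> (h \<otimes> (g \<otimes> \<rho> x \<otimes> inv g) \<otimes> inv h)"
      using conj clo x gx g by simp
    then show ?case using cc[OF g conj.hyps(2) clo(1)[OF conj.hyps(1) x]] by simp
  next
    case (prod \<rho> \<sigma>)
    have gx: "g \<otimes> x \<otimes> inv g \<in> V" using V.inv_op_closed2 g x by blast
    have "W #> (\<rho> (g \<otimes> x \<otimes> inv g) \<otimes> \<sigma> (g \<otimes> x \<otimes> inv g))
        = W #> (g \<otimes> \<rho> x \<otimes> inv g \<otimes> (g \<otimes> \<sigma> x \<otimes> inv g))"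
      using prod clo gx x g by simp
    also have "g \<otimes> \<rho> x \<otimes> inv g \<otimes> (g \<otimes> \<sigma> x \<otimes> inv g) = g \<otimes> (\<rho> x \<otimes> \<sigma> x) \<otimes> inv g"
      using clo(2)[OF prod.hyps(1) x] clo(2)[OF prod.hyps(2) x] g
      by (simp add: m_assoc inv_mult_cancel)
    finally show ?case .
  next
    case (inverse \<rho>)
    have gx: "g \<otimes> x \<otimes> inv g \<in> V" using V.inv_op_closed2 g x by blast
    have "W #> inv (\<rho> (g \<otimes> x \<otimes> inv g)) = W #> inv (g \<otimes> \<rho> x \<otimes> inv g)"
      using inverse clo gx x g by simp
    also have "inv (g \<otimes> \<rho> x \<otimes> inv g) = g \<otimes> inv \<rho> x \<otimes> inv g"
      using inverse.hyps clo x g by (simp add: m_assoc inv_mult_group)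
    finally show ?case .
  qed simp
  ultimately show ?thesis
    using clo(1)[OF assms(5)] by (simp add: equivariant_mod_def)
qed

text \<open>With \<open>\<phi> u = \<rho> u\<close> and \<open>\<psi> u = \<sigma> u\<close> for words \<open>\<rho>\<close> and \<open>\<sigma>\<close>, endomorphisms commute with words and words
  commute with each other, so modulo \<open>W\<close>
  \<open>\<phi> (\<psi> u) = \<phi> (\<sigma> u) = \<sigma> (\<phi> u) = \<sigma> (\<rho> u) = \<rho> (\<sigma> u) = \<rho> (\<psi> u) = \<psi> (\<rho> u) = \<psi> (\<phi> u)\<close>.
  Since \<open>M\<close> centralizes \<open>V/W\<close>, conjugation by \<open>g\<close> on \<open>V/W\<close> depends only on the coset of \<open>g\<close> modulo
  \<open>M\<close>. This makes automorphisms acting trivially on \<open>G/M\<close> equivariant and, as \<open>G/M\<close> is abelian,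
  makes the actions of elements of \<open>G\<close> commute.\<close>

lemma (in group) normal_autos_commute_on_section:
  assumes M: "M \<lhd> G" and V: "V \<lhd> G" and W: "W \<lhd> G" and VM: "V \<subseteq> M"
    and abG: "\<And>g h. \<lbrakk>g \<in> carrier G; h \<in> carrier G\<rbrakk> \<Longrightarrow> M #> (g \<otimes> h) = M #> (h \<otimes> g)"
    and cen: "\<And>m v. \<lbrakk>m \<in> M; v \<in> V\<rbrakk> \<Longrightarrow> W #> (m \<otimes> v) = W #> (v \<otimes> m)"
    and p: "\<phi> \<in> trivial_action G (carrier G) M" and q: "\<psi> \<in> trivial_action G (carrier G) M"
    and u: "u \<in> V"
  shows "W #> \<phi> (\<psi> u) = W #> \<psi> (\<phi> u)"
proof -
  interpret V: normal V G by (rule V)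
  interpret M: normal M G by (rule M)
  interpret W: normal W G by (rule W)
  interpret p: group_hom G "G Mod W" "\<lambda>a. W #> a" by (rule W.r_coset_group_hom)
  note [simp del] = mult_FactGroup
  have conjM: "W #> (m \<otimes> v \<otimes> inv m) = W #> v" if "m \<in> M" "v \<in> V" for m v
  proof -
    have c: "m \<in> carrier G" "v \<in> carrier G" using that by auto
    have "W #> (m \<otimes> v \<otimes> inv m) = (W #> (m \<otimes> v)) \<otimes>\<^bsub>G Mod W\<^esub> (W #> inv m)"
      using c p.hom_mult[of "m \<otimes> v" "inv m"] by simp
    also have "\<dots> = W #> (v \<otimes> m \<otimes> inv m)"
      using cen[OF that] c p.hom_mult[of "v \<otimes> m" "inv m"] by simp
    finally show ?thesis using c by (simp add: m_assoc del: p.hom_mult)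
  qed
  \<comment> \<open>Conjugation on \<open>V/W\<close> factors through \<open>G/M\<close>.\<close>
  have cM: "W #> (a \<otimes> v \<otimes> inv a) = W #> (b \<otimes> v \<otimes> inv b)"
    if ab: "a \<in> carrier G" "b \<in> carrier G" "M #> a = M #> b" and v: "v \<in> V" for a b v
  proof -
    obtain m where m: "m \<in> M" "a = m \<otimes> b"
      using rcos_eq_cases[OF M.subgroup_axioms ab(2,1,3)] by blast
    have "a \<otimes> v \<otimes> inv a = m \<otimes> (b \<otimes> v \<otimes> inv b) \<otimes> inv m"
      using m ab v by (simp add: m_assoc inv_mult_group)
    then show ?thesis using conjM[OF m(1) V.inv_op_closed2[OF ab(2) v]] by simp
  qed
  have cc: "W #> (g \<otimes> (h \<otimes> v \<otimes> inv h) \<otimes> inv g) = W #> (h \<otimes> (g \<otimes> v \<otimes> inv g) \<otimes> inv h)"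
    if gh: "g \<in> carrier G" "h \<in> carrier G" and v: "v \<in> V" for g h v
    using cM[OF _ _ abG[OF gh] v] gh v by (simp add: m_assoc inv_mult_group del: p.hom_mult)
  have ab: "W #> (x \<otimes> y) = W #> (y \<otimes> x)" if "x \<in> V" "y \<in> V" for x y
    using cen[of x y] that VM by blast
  have eq_auto: "equivariant_mod G V W \<theta>" if t: "\<theta> \<in> trivial_action G (carrier G) M" for \<theta>
  proof -
    interpret \<theta>: group_hom G G \<theta> by (rule normal_autos_hom[OF trivial_actionD(1)[OF t]])
    have tv: "\<theta> x \<in> V" if "x \<in> V" for x
      by (rule normal_autos_mem[OF trivial_actionD(1)[OF t] V that])
    have "W #> \<theta> (g \<otimes> x \<otimes> inv g) = W #> (g \<otimes> \<theta> x \<otimes> inv g)" if "g \<in> carrier G" "x \<in> V" for g x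
      using cM[OF _ that(1) trivial_actionD(2)[OF t that(1)] tv[OF that(2)]] that
      by (simp del: p.hom_mult)
    then show ?thesis using tv by (simp add: equivariant_mod_def del: p.hom_mult)
  qed
  have uc: "u \<in> carrier G" using u by simp
  obtain \<rho> where r: "\<rho> \<in> conj_words G" "\<phi> u = \<rho> u"
    using normal_autos_conj_word[OF trivial_actionD(1)[OF p] uc] .
  obtain \<sigma> where s: "\<sigma> \<in> conj_words G" "\<psi> u = \<sigma> u"
    using normal_autos_conj_word[OF trivial_actionD(1)[OF q] uc] .
  have "W #> \<phi> (\<psi> u) = W #> \<sigma> (\<rho> u)"
    using equivariant_conj_word[OF V W eq_auto[OF p] s(1) u] s(2) r(2) by simp
  also have "\<dots> = W #> \<rho> (\<sigma> u)"
    by (rule equivariant_conj_word[OF V W conj_word_equivariant[OF V W ab cc s(1)] r(1) u])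
  also have "\<dots> = W #> \<psi> (\<phi> u)"
    using equivariant_conj_word[OF V W eq_auto[OF q] r(1) u] s(2) r(2) by simp
  finally show ?thesis .
qed

section \<open>The stability group of the series\<close>

text \<open>The properties of the series \<open>G, \<gamma>\<^sub>1(M), \<gamma>\<^sub>2(M), \<dots>\<close> on which the argument rests: the top factor is
  abelian, and the series below \<open>L 1\<close> is central in \<open>L 1\<close>. The index is shifted so that \<open>L 0\<close> is the
  whole group and \<open>L (Suc i)\<close> is the term of index \<open>i\<close> of the lower central series of \<open>M = L 1\<close>.\<close>

locale abelian_by_central_series = group G for G :: "('a, 'b) monoid_scheme" (structure) +
  fixes L :: "nat \<Rightarrow> 'a set"
  assumes L_normal: "L j \<lhd> G"
    and L_0: "L 0 = carrier G"
    and L_subset: "L (Suc j) \<subseteq> L 1"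
    and L_abelian: "\<lbrakk>g \<in> carrier G; h \<in> carrier G\<rbrakk> \<Longrightarrow> L 1 #> (g \<otimes> h) = L 1 #> (h \<otimes> g)"
    and L_central: "\<lbrakk>m \<in> L 1; v \<in> L (Suc j)\<rbrakk>
      \<Longrightarrow> L (Suc (Suc j)) #> (m \<otimes> v) = L (Suc (Suc j)) #> (v \<otimes> m)"
begin

text \<open>Level \<open>0\<close> is the stability group of the series; level \<open>n\<close> moves elements \<open>n + 1\<close> steps down.\<close>

definition stability :: "nat \<Rightarrow> ('a \<Rightarrow> 'a) set" where
  "stability n = (\<Inter>j. trivial_action G (L j) (L (Suc (j + n))))"

lemma L_carrier: "x \<in> L j \<Longrightarrow> x \<in> carrier G"
  using L_normal by (meson normal_imp_subgroup subgroup.mem_carrier)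

lemma stability_normal: "stability n \<lhd> NormalAutoGroup G"
proof -
  interpret A: group "NormalAutoGroup G" by (rule group_NormalAutoGroup)
  have T: "trivial_action G (L j) (L (Suc (j + n))) \<lhd> NormalAutoGroup G" for j
    by (rule trivial_action_normal[OF L_normal L_normal])
  show ?thesis
    unfolding stability_def
  proof (rule A.normal_invI)
    show "subgroup (\<Inter>j. trivial_action G (L j) (L (Suc (j + n)))) (NormalAutoGroup G)"
      by (rule A.subgroups_Inter) (auto intro: normal_imp_subgroup[OF T])
  qed (simp add: A.normal_invE(2)[OF T])
qed

lemma stability_memD:
  assumes "\<alpha> \<in> stability n"
  shows "\<alpha> \<in> trivial_action G (L j) (L (Suc (j + n)))" "\<alpha> \<in> normal_autos G"
  using assms trivial_actionD(1) unfolding stability_def by blast+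

lemma stability_commutator:
  assumes a: "\<alpha> \<in> stability n" and b: "\<beta> \<in> stability 0"
  shows "\<alpha> \<otimes>\<^bsub>NormalAutoGroup G\<^esub> \<beta> \<otimes>\<^bsub>NormalAutoGroup G\<^esub> inv\<^bsub>NormalAutoGroup G\<^esub> \<alpha>
           \<otimes>\<^bsub>NormalAutoGroup G\<^esub> inv\<^bsub>NormalAutoGroup G\<^esub> \<beta> \<in> stability (Suc n)"
  unfolding stability_def
proof (intro INT_I)
  fix j
  show "\<alpha> \<otimes>\<^bsub>NormalAutoGroup G\<^esub> \<beta> \<otimes>\<^bsub>NormalAutoGroup G\<^esub> inv\<^bsub>NormalAutoGroup G\<^esub> \<alpha>
           \<otimes>\<^bsub>NormalAutoGroup G\<^esub> inv\<^bsub>NormalAutoGroup G\<^esub> \<beta> \<in> trivial_action G (L j) (L (Suc (j + Suc n)))"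
  proof (rule commutator_trivial_action[OF stability_memD(2)[OF a] stability_memD(2)[OF b] L_normal])
    fix g assume g: "g \<in> L j"
    show "L (Suc (j + Suc n)) #> \<alpha> (\<beta> g) = L (Suc (j + Suc n)) #> \<beta> (\<alpha> g)"
    proof (rule trivial_action_commute[OF L_normal L_normal L_normal])
      show "\<alpha> \<in> trivial_action G (L j) (L (Suc (j + n)))" by (rule stability_memD(1)[OF a])
      show "\<alpha> \<in> trivial_action G (L (Suc j)) (L (Suc (j + Suc n)))"
        using stability_memD(1)[OF a, of "Suc j"] by simp
      show "\<beta> \<in> trivial_action G (L j) (L (Suc j))"
        using stability_memD(1)[OF b, of j] by simp
      show "\<beta> \<in> trivial_action G (L (Suc (j + n))) (L (Suc (j + Suc n)))"
        using stability_memD(1)[OF b, of "Suc (j + n)"] by simp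
      show "g \<in> L j" by (rule g)
      show "g \<in> carrier G" using g by (rule L_carrier)
      fix t u assume "t \<in> L (Suc (j + n))" "u \<in> L (Suc j)"
      then show "L (Suc (j + Suc n)) #> (t \<otimes> u) = L (Suc (j + Suc n)) #> (u \<otimes> t)"
        using L_central[of u t "j + n"] L_subset by auto
    qed
  qed
qed

end

lemma (in group) lower_central_subset: "lower_central G n \<subseteq> carrier G"
proof (induction n)
  case (Suc n)
  show ?case
    unfolding lower_central.simps
    by (rule generate_incl) (use Suc in \<open>auto simp: subset_iff\<close>)
qed simp

lemma (in group) lower_central_subgroup_Suc:
  assumes H: "subgroup H G"
  shows "lower_central (G\<lparr>carrier := H\<rparr>) (Suc n) =
    generate G (\<Union>x\<in>lower_central (G\<lparr>carrier := H\<rparr>) n. \<Union>y\<in>H. {x \<otimes> y \<otimes> inv x \<otimes> inv y})"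
proof -
  have sub: "x \<in> H" if "x \<in> lower_central (G\<lparr>carrier := H\<rparr>) n" for x
    using group.lower_central_subset[OF subgroup_imp_group[OF H], of n] that by auto
  let ?C = "\<Union>x\<in>lower_central (G\<lparr>carrier := H\<rparr>) n. \<Union>y\<in>H. {x \<otimes> y \<otimes> inv x \<otimes> inv y}"
  have C: "?C = (\<Union>x\<in>lower_central (G\<lparr>carrier := H\<rparr>) n. \<Union>y\<in>H.
    {x \<otimes> y \<otimes> inv\<^bsub>G\<lparr>carrier := H\<rparr>\<^esub> x \<otimes> inv\<^bsub>G\<lparr>carrier := H\<rparr>\<^esub> y})"
    by (intro SUP_cong refl) (simp add: m_inv_consistent[OF H] sub)
  have "?C \<subseteq> H"
    using sub subgroup.m_closed[OF H] subgroup.m_inv_closed[OF H] by (simp add: UN_subset_iff)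
  from generate_consistent[OF this H] show ?thesis
    by (simp add: C)
qed

lemma (in abelian_by_central_series) lower_central_stability:
  "lower_central (NormalAutoGroup G\<lparr>carrier := stability 0\<rparr>) n \<subseteq> stability n"
proof (induction n)
  case (Suc n)
  interpret A: group "NormalAutoGroup G" by (rule group_NormalAutoGroup)
  show ?case
    unfolding A.lower_central_subgroup_Suc[OF normal_imp_subgroup[OF stability_normal]]
  proof (rule A.generate_subgroup_incl[OF _ normal_imp_subgroup[OF stability_normal]],
      intro UN_least)
    fix \<alpha> \<beta>
    assume "\<alpha> \<in> lower_central (NormalAutoGroup G\<lparr>carrier := stability 0\<rparr>) n" and "\<beta> \<in> stability 0"
    then show "{\<alpha> \<otimes>\<^bsub>NormalAutoGroup G\<^esub> \<beta> \<otimes>\<^bsub>NormalAutoGroup G\<^esub> inv\<^bsub>NormalAutoGroup G\<^esub> \<alpha>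
      \<otimes>\<^bsub>NormalAutoGroup G\<^esub> inv\<^bsub>NormalAutoGroup G\<^esub> \<beta>} \<subseteq> stability (Suc n)"
      using Suc stability_commutator[of \<alpha> n \<beta>] by (simp add: subsetD)
  qed
qed simp

lemma (in abelian_by_central_series) stability_trivial:
  assumes "L (Suc c) = {\<one>}"
  shows "stability c \<subseteq> {\<one>\<^bsub>NormalAutoGroup G\<^esub>}"
proof
  fix \<alpha> assume a: "\<alpha> \<in> stability c"
  have ext: "\<alpha> \<in> extensional (carrier G)"
    using stability_memD(2)[OF a] by (simp add: normal_autos_def auto_def Bij_def)
  have "\<alpha> g = g" if g: "g \<in> carrier G" for g
  proof -
    have "\<alpha> \<in> trivial_action G (carrier G) {\<one>}"
      using stability_memD(1)[OF a, of 0] assms L_0 by simp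
    moreover have "\<alpha> g \<in> carrier G"
      by (rule normal_autos_mem[OF stability_memD(2)[OF a] normal_self g])
    ultimately show ?thesis
      using trivial_actionD(2)[of \<alpha> G "carrier G" "{\<one>}" g] g by (simp add: r_coset_def)
  qed
  then have "\<alpha> = (\<lambda>x\<in>carrier G. x)" using ext by (intro extensionalityI) auto
  then show "\<alpha> \<in> {\<one>\<^bsub>NormalAutoGroup G\<^esub>}"
    by (simp add: NormalAutoGroup_def AutoGroup_simps)
qed

lemma (in abelian_by_central_series) stability_nilpotent:
  assumes "L (Suc c) = {\<one>}"
  shows "nilpotent_of_class_le c (NormalAutoGroup G\<lparr>carrier := stability 0\<rparr>)"
proof -
  interpret A: group "NormalAutoGroup G" by (rule group_NormalAutoGroup)
  let ?S = "NormalAutoGroup G\<lparr>carrier := stability 0\<rparr>"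
  have S: "group ?S" by (rule A.subgroup_imp_group[OF normal_imp_subgroup[OF stability_normal]])
  have "\<one>\<^bsub>?S\<^esub> \<in> lower_central ?S n" for n
  proof (cases n)
    case 0
    then show ?thesis using monoid.one_closed[OF group.is_monoid[OF S]] by simp
  next
    case (Suc m)
    then show ?thesis unfolding Suc lower_central.simps by (intro generate.one)
  qed
  then have "lower_central ?S c = {\<one>\<^bsub>?S\<^esub>}"
    using lower_central_stability[of c] stability_trivial[OF assms] by fastforce
  then show ?thesis
    using S by (auto simp: nilpotent_of_class_le_def nilpotent_group_def nilpotency_class_def
      intro: Least_le)
qed

lemma (in group) comm_group_Mod_if_commutators:
  assumes N: "N \<lhd> G"
    and comm: "\<And>x y. \<lbrakk>x \<in> carrier G; y \<in> carrier G\<rbrakk> \<Longrightarrow> x \<otimes> y \<otimes> inv x \<otimes> inv y \<in> N"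
  shows "comm_group (G Mod N)"
proof -
  interpret N: normal N G by (rule N)
  show ?thesis
  proof (rule group.group_comm_groupI[OF N.factorgroup_is_group])
    fix A B assume "A \<in> carrier (G Mod N)" "B \<in> carrier (G Mod N)"
    then obtain x y where xy: "x \<in> carrier G" "y \<in> carrier G" "A = N #> x" "B = N #> y"
      by (auto simp: carrier_FactGroup)
    have "x \<otimes> y = x \<otimes> y \<otimes> inv x \<otimes> inv y \<otimes> (y \<otimes> x)"
      using xy by (simp add: m_assoc inv_mult_cancel)
    then have "x \<otimes> y \<in> N #> (y \<otimes> x)"
      using comm[OF xy(1,2)] by (force simp: r_coset_def)
    then have "N #> (y \<otimes> x) = N #> (x \<otimes> y)"
      using xy by (intro repr_independence N.subgroup_axioms) auto
    then show "A \<otimes>\<^bsub>G Mod N\<^esub> B = B \<otimes>\<^bsub>G Mod N\<^esub> A"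
      using xy by (simp add: N.rcos_sum)
  qed
qed

text \<open>On the top factor both automorphisms act trivially; on the factor below \<open>L (Suc i)\<close> they commute
  because they act as elements of a commutative group ring on each single element.\<close>

lemma (in abelian_by_central_series) commutator_in_stability:
  assumes p: "\<phi> \<in> trivial_action G (carrier G) (L 1)" and q: "\<psi> \<in> trivial_action G (carrier G) (L 1)"
  shows "\<phi> \<otimes>\<^bsub>NormalAutoGroup G\<^esub> \<psi> \<otimes>\<^bsub>NormalAutoGroup G\<^esub> inv\<^bsub>NormalAutoGroup G\<^esub> \<phi>
           \<otimes>\<^bsub>NormalAutoGroup G\<^esub> inv\<^bsub>NormalAutoGroup G\<^esub> \<psi> \<in> stability 0"
  unfolding stability_def
proof (intro INT_I, simp only: add_0_right)
  note pn = trivial_actionD(1)[OF p] and qn = trivial_actionD(1)[OF q]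
  fix j
  have "L (Suc j) #> \<phi> (\<psi> g) = L (Suc j) #> \<psi> (\<phi> g)" if g: "g \<in> L j" for g
  proof (cases j)
    case 0
    have gc: "g \<in> carrier G" using g by (rule L_carrier)
    have "\<psi> g \<in> carrier G" "\<phi> g \<in> carrier G"
      using normal_autos_mem[OF _ normal_self gc] pn qn by auto
    then show ?thesis
      using trivial_actionD(2)[OF p] trivial_actionD(2)[OF q] gc 0 by simp
  next
    case (Suc i)
    have "L (Suc (Suc i)) #> \<phi> (\<psi> g) = L (Suc (Suc i)) #> \<psi> (\<phi> g)"
      using normal_autos_commute_on_section[OF L_normal L_normal L_normal L_subset L_abelian
        L_central p q] g Suc by blast
    then show ?thesis using Suc by simp
  qed
  then show "\<phi> \<otimes>\<^bsub>NormalAutoGroup G\<^esub> \<psi> \<otimes>\<^bsub>NormalAutoGroup G\<^esub> inv\<^bsub>NormalAutoGroup G\<^esub> \<phi>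
     \<otimes>\<^bsub>NormalAutoGroup G\<^esub> inv\<^bsub>NormalAutoGroup G\<^esub> \<psi> \<in> trivial_action G (L j) (L (Suc j))"
    by (rule commutator_trivial_action[OF pn qn L_normal])
qed

lemma (in abelian_by_central_series) trivial_action_nilpotent_by_abelian:
  assumes "L (Suc c) = {\<one>}"
  shows "group_by_group (nilpotent_of_class_le c) comm_group
    (NormalAutoGroup G\<lparr>carrier := trivial_action G (carrier G) (L 1)\<rparr>)"
proof -
  interpret A: group "NormalAutoGroup G" by (rule group_NormalAutoGroup)
  let ?K = "trivial_action G (carrier G) (L 1)"
  have K: "subgroup ?K (NormalAutoGroup G)"
    by (rule normal_imp_subgroup[OF trivial_action_normal[OF normal_self L_normal]])
  have "stability 0 \<subseteq> ?K"
    using stability_memD(1)[of _ 0 0] L_0 by (simp add: subset_iff)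
  then have N: "stability 0 \<lhd> NormalAutoGroup G\<lparr>carrier := ?K\<rparr>"
    by (rule A.normal_restrict_supergroup[OF K stability_normal])
  have "comm_group (NormalAutoGroup G\<lparr>carrier := ?K\<rparr> Mod stability 0)"
    by (rule group.comm_group_Mod_if_commutators[OF A.subgroup_imp_group[OF K] N])
      (simp add: A.m_inv_consistent[OF K] commutator_in_stability del: One_nat_def)
  then show ?thesis
    unfolding group_by_group_def using N stability_nilpotent[OF assms]
    by (intro exI[of _ "stability 0"]) simp
qed

lemma (in group) abelian_by_lower_central_series:
  assumes M: "M \<lhd> G" and ab: "comm_group (G Mod M)"
  shows "abelian_by_central_series G
    (\<lambda>j. case j of 0 \<Rightarrow> carrier G | Suc i \<Rightarrow> lower_central (G\<lparr>carrier := M\<rparr>) i)"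
proof -
  interpret M: normal M G by (rule M)
  let ?lc = "lower_central (G\<lparr>carrier := M\<rparr>)"
  note Suc_eq = lower_central_subgroup_Suc[OF M.subgroup_axioms]
  have sub: "?lc i \<subseteq> M" for i
    using group.lower_central_subset[OF subgroup_imp_group[OF M.subgroup_axioms], of i] by simp
  have norm: "?lc i \<lhd> G" for i
  proof (induction i)
    case 0
    show ?case using M by simp
  next
    case (Suc i)
    interpret I: normal "?lc i" G by (rule Suc)
    show ?case
      unfolding Suc_eq
    proof (rule normal_generateI)
      show "(\<Union>x\<in>?lc i. \<Union>y\<in>M. {x \<otimes> y \<otimes> inv x \<otimes> inv y}) \<subseteq> carrier G" by auto
      fix h g assume "h \<in> (\<Union>x\<in>?lc i. \<Union>y\<in>M. {x \<otimes> y \<otimes> inv x \<otimes> inv y})" and g: "g \<in> carrier G"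
      then obtain x y where xy: "x \<in> ?lc i" "y \<in> M" "h = x \<otimes> y \<otimes> inv x \<otimes> inv y" by blast
      let ?x = "g \<otimes> x \<otimes> inv g" and ?y = "g \<otimes> y \<otimes> inv g"
      have c: "x \<in> carrier G" "y \<in> carrier G" using xy by auto
      have "g \<otimes> h \<otimes> inv g = ?x \<otimes> ?y \<otimes> inv ?x \<otimes> inv ?y"
        using c g by (simp add: xy(3) m_assoc inv_mult_group inv_mult_cancel)
      moreover have "?x \<in> ?lc i" "?y \<in> M"
        using I.inv_op_closed2 M.inv_op_closed2 g xy by auto
      ultimately show "g \<otimes> h \<otimes> inv g \<in> (\<Union>x\<in>?lc i. \<Union>y\<in>M. {x \<otimes> y \<otimes> inv x \<otimes> inv y})"
        by blast
    qed
  qed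
  have cen: "?lc (Suc i) #> (m \<otimes> v) = ?lc (Suc i) #> (v \<otimes> m)" if m: "m \<in> M" and v: "v \<in> ?lc i" for m v i
  proof -
    interpret I: normal "?lc (Suc i)" G by (rule norm)
    have c: "m \<in> carrier G" "v \<in> carrier G" using m v sub[of i] by auto
    have "v \<otimes> m \<otimes> inv v \<otimes> inv m \<in> ?lc (Suc i)"
      unfolding Suc_eq using m v by (intro generate.incl) blast
    moreover have "v \<otimes> m = v \<otimes> m \<otimes> inv v \<otimes> inv m \<otimes> (m \<otimes> v)"
      using c by (simp add: m_assoc inv_mult_cancel)
    ultimately have "v \<otimes> m \<in> ?lc (Suc i) #> (m \<otimes> v)"
      by (force simp: r_coset_def simp del: lower_central.simps)
    then show ?thesis
      using c by (intro repr_independence I.subgroup_axioms) auto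
  qed
  show ?thesis
  proof (intro abelian_by_central_series.intro abelian_by_central_series_axioms.intro is_group,
      goal_cases)
    case (1 j)
    then show ?case using norm normal_self by (simp split: nat.split)
  next
    case (4 g h)
    have "(M #> g) \<otimes>\<^bsub>G Mod M\<^esub> (M #> h) = (M #> h) \<otimes>\<^bsub>G Mod M\<^esub> (M #> g)"
      using comm_groupE(4)[OF ab] 4 by (simp add: carrier_FactGroup)
    then show ?case using 4 by (simp add: M.rcos_sum)
  next
    case (5 m v j)
    then show ?case using cen[of m v j] by (simp del: lower_central.simps(2))
  qed (use sub in auto)
qed

section \<open>Finite index\<close>

text \<open>A function with finite range that separates the right cosets of \<open>K\<close> bounds their number.\<close>

lemma (in group) finite_rcosets_if_finite_invariant:
  assumes K: "subgroup K G" and fin: "finite (f ` carrier G)"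
    and eq: "\<And>a b. \<lbrakk>a \<in> carrier G; b \<in> carrier G; f a = f b\<rbrakk> \<Longrightarrow> a \<otimes> inv b \<in> K"
  shows "finite (rcosets K)"
proof -
  interpret K: subgroup K G by (rule K)
  let ?r = "\<lambda>v. K #> (SOME b. b \<in> carrier G \<and> f b = v)"
  have "rcosets K \<subseteq> ?r ` f ` carrier G"
  proof
    fix C assume "C \<in> rcosets K"
    then obtain a where a: "a \<in> carrier G" "C = K #> a" by (auto simp: RCOSETS_def)
    define b where "b = (SOME b. b \<in> carrier G \<and> f b = f a)"
    have b: "b \<in> carrier G \<and> f b = f a"
      unfolding b_def by (rule someI[of _ a]) (simp add: a)
    have "a \<in> K #> b"
      using eq[of a b] a b by (intro K.rcos_module_rev is_group) auto
    then have "C = K #> b"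
      using repr_independence[of a K b] K a b by simp
    then show "C \<in> ?r ` f ` carrier G" using a(1) unfolding b_def by blast
  qed
  then show ?thesis using fin finite_surj[of "f ` carrier G" "rcosets K" ?r] by blast
qed

text \<open>If \<open>a\<close> has infinite order, then \<open>\<alpha> a\<close> generates the same cyclic group as \<open>a\<close>, so \<open>\<alpha> a = a\<^sup>e\<close> with
  \<open>e = 1\<close> or \<open>e = -1\<close>. The exponent is the same for every other \<open>b\<close>: with \<open>\<alpha> b = b\<^sup>k\<close> and
  \<open>\<alpha> (a b) = (a b)\<^sup>l\<close>, the relation \<open>a\<^sup>e\<^sup>-\<^sup>l = b\<^sup>l\<^sup>-\<^sup>k\<close> holds. If \<open>b\<close> has finite order, both sides are
  trivial because powers of \<open>a\<close> are not torsion, so \<open>b\<^sup>k = b\<^sup>e\<close>. If \<open>b\<close> has infinite order,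
  applying \<open>\<alpha>\<close> to the relation gives \<open>(k - e) (l - k) = 0\<close>, and either factor yields \<open>k = e\<close>.\<close>

lemma (in comm_group) power_automorphism_cases:
  assumes \<alpha>: "\<alpha> \<in> hom G G"
    and pow: "\<And>x. x \<in> carrier G \<Longrightarrow> \<exists>k::int. \<alpha> x = x [^] k"
    and a: "a \<in> carrier G" "ord a = 0" "\<exists>m::int. a = \<alpha> a [^] m"
  shows "(\<forall>x\<in>carrier G. \<alpha> x = x) \<or> (\<forall>x\<in>carrier G. \<alpha> x = inv x)"
proof -
  interpret \<alpha>: group_hom G G \<alpha> by unfold_locales (rule \<alpha>)
  have inj: "i = j" if "a [^] (i::int) = a [^] j" for i j
    using int_pow_eq[OF a(1), of i j] that a(2) by simp
  obtain e :: int where e: "\<alpha> a = a [^] e" using pow[OF a(1)] by blast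
  obtain m :: int where m: "a = \<alpha> a [^] m" using a(3) by blast
  have "a [^] (e * m) = a [^] (1::int)"
    using m e a(1) by (simp add: int_pow_pow)
  then have "e * m = 1" by (rule inj)
  then have e1: "e = 1 \<or> e = -1" by (simp add: zmult_eq_1_iff) auto
  have "\<alpha> b = b [^] e" if b: "b \<in> carrier G" for b
  proof -
    obtain k :: int where k: "\<alpha> b = b [^] k" using pow[OF b] by blast
    obtain l :: int where l: "\<alpha> (a \<otimes> b) = (a \<otimes> b) [^] l" using pow[of "a \<otimes> b"] a(1) b by auto
    have "a [^] e \<otimes> b [^] k = a [^] l \<otimes> b [^] l"
      using l e k a(1) b by (simp add: int_pow_distrib)
    then have ab: "a [^] (e - l) = b [^] (l - k)"
    proof -
      have "a [^] e = a [^] l \<otimes> (b [^] l \<otimes> inv (b [^] k))"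
        using \<open>a [^] e \<otimes> b [^] k = a [^] l \<otimes> b [^] l\<close> a(1) b
        by (simp add: inv_solve_right flip: m_assoc)
      also have "\<dots> = (b [^] l \<otimes> inv (b [^] k)) \<otimes> a [^] l"
        using a(1) b by (simp add: m_comm)
      finally have "a [^] e \<otimes> inv (a [^] l) = b [^] l \<otimes> inv (b [^] k)"
        using a(1) b by (simp add: inv_solve_right')
      then show ?thesis using a(1) b by (simp add: int_pow_diff)
    qed
    have "b [^] (e * (l - k)) = \<alpha> (b [^] (l - k))"
    proof -
      have "b [^] (e * (l - k)) = (a [^] (e - l)) [^] e"
        using ab b by (simp add: int_pow_pow mult.commute)
      also have "\<dots> = \<alpha> (a [^] (e - l))"
        using a(1) e by (simp add: \<alpha>.hom_int_pow int_pow_pow mult.commute)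
      finally show ?thesis using ab by simp
    qed
    also have "\<dots> = b [^] (k * (l - k))"
      using b k by (simp add: \<alpha>.hom_int_pow int_pow_pow)
    finally have d: "int (ord b) dvd (k - e) * (l - k)"
      using int_pow_eq[OF b] by (simp add: algebra_simps)
    show ?thesis
    proof (cases "ord b = 0")
      case True
      then have "k = e \<or> l = k" using d by auto
      moreover have "e = l" if "l = k"
        using inj[of "e - l" 0] ab that by simp
      ultimately show ?thesis using k by auto
    next
      case False
      have "a [^] ((e - l) * int (ord b)) = (b [^] (l - k)) [^] int (ord b)"
        using ab a(1) by (simp flip: int_pow_pow)
      also have "\<dots> = a [^] (0::int)"
        using b int_pow_eq_id[OF b] by (simp add: int_pow_pow)
      finally have "(e - l) * int (ord b) = 0" by (rule inj)
      then have "e = l" using False by simp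
      then have "b [^] (e - k) = \<one>" using ab by simp
      then have "int (ord b) dvd e - k" using int_pow_eq_id[OF b] by blast
      then show ?thesis using k int_pow_eq[OF b, of k e] by simp
    qed
  qed
  then show ?thesis using e1 by (auto simp: int_pow_neg)
qed

text \<open>The union of the cosets in a cyclic subgroup of \<open>G/D\<close> is a normal subgroup of \<open>G\<close>, since \<open>G/D\<close> is
  abelian. It is preserved by \<open>\<phi>\<close>, so \<open>\<phi>\<close> induces on \<open>G/D\<close> an automorphism mapping each cyclic
  subgroup onto itself.\<close>

lemma (in group) normal_autos_on_abelian_quotient:
  assumes D: "D \<lhd> G" and ab: "comm_group (G Mod D)" and np: "non_periodic (G Mod D)"
    and p: "\<phi> \<in> normal_autos G"
  shows "(\<forall>C\<in>carrier (G Mod D). \<phi> ` C = C) \<or> (\<forall>C\<in>carrier (G Mod D). \<phi> ` C = inv\<^bsub>G Mod D\<^esub> C)"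
proof -
  interpret D: normal D G by (rule D)
  interpret Q: comm_group "G Mod D" by (rule ab)
  interpret \<phi>: group_hom G G \<phi> by (rule normal_autos_hom[OF p])
  have img: "\<phi> ` (D #> x) = D #> \<phi> x" if "x \<in> carrier G" for x
    by (rule normal_autos_image_rcos[OF p D that])
  have hom: "(`) \<phi> \<in> hom (G Mod D) (G Mod D)"
  proof (rule homI)
    fix A B assume "A \<in> carrier (G Mod D)" "B \<in> carrier (G Mod D)"
    then obtain x y where xy: "x \<in> carrier G" "y \<in> carrier G" "A = D #> x" "B = D #> y"
      by (auto simp: carrier_FactGroup)
    then show "\<phi> ` A \<in> carrier (G Mod D)" by (simp add: carrier_FactGroup img)
    show "\<phi> ` (A \<otimes>\<^bsub>G Mod D\<^esub> B) = \<phi> ` A \<otimes>\<^bsub>G Mod D\<^esub> \<phi> ` B"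
      using xy img[of "x \<otimes> y"] by (simp add: img D.rcos_sum)
  qed
  interpret \<alpha>: group_hom "G Mod D" "G Mod D" "(`) \<phi>" by unfold_locales (rule hom)
  have cyc: "(\<exists>k::int. \<phi> ` C = C [^]\<^bsub>G Mod D\<^esub> k) \<and> (\<exists>k::int. C = (\<phi> ` C) [^]\<^bsub>G Mod D\<^esub> k)"
    if C: "C \<in> carrier (G Mod D)" for C
  proof -
    let ?H = "generate (G Mod D) {C}"
    have H: "subgroup ?H (G Mod D)" using Q.generate_is_subgroup C by simp
    have U: "\<Union>?H \<lhd> G"
      by (rule D.factgroup_subgroup_union_normal[OF Q.subgroup_imp_normal[OF H]])
    have mem: "x \<in> \<Union>?H \<longleftrightarrow> x \<in> carrier G \<and> D #> x \<in> ?H" for x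
      unfolding D.factgroup_subgroup_union_char[OF H] by simp
    have Hpow: "?H = {C [^]\<^bsub>G Mod D\<^esub> (k::int) | k. k \<in> UNIV}" by (rule Q.generate_pow[OF C])
    obtain x where x: "x \<in> carrier G" "C = D #> x" using C by (auto simp: carrier_FactGroup)
    have xU: "x \<in> \<Union>?H" unfolding mem using x generate.incl[of C "{C}" "G Mod D"] by simp
    then have "\<phi> x \<in> \<Union>?H" by (rule normal_autos_mem[OF p U])
    then have "\<phi> ` C \<in> ?H" unfolding mem using x img by simp
    moreover have "x \<in> \<phi> ` \<Union>?H" using xU normal_autos_image[OF p U] by simp
    then obtain y where y: "y \<in> \<Union>?H" "x = \<phi> y" by blast
    then obtain k :: int where k: "y \<in> carrier G" "D #> y = C [^]\<^bsub>G Mod D\<^esub> k"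
      using mem Hpow by blast
    have "C = (\<phi> ` C) [^]\<^bsub>G Mod D\<^esub> k"
      using img[OF k(1)] k(2) y(2) x(2) \<alpha>.hom_int_pow[OF C] by simp
    ultimately show ?thesis using Hpow by blast
  qed
  obtain A where A: "A \<in> carrier (G Mod D)" "Q.ord A = 0"
    using np by (auto simp: non_periodic_def)
  show ?thesis
    using Q.power_automorphism_cases[OF hom _ A] cyc A(1) by blast
qed

text \<open>The induced permutation of \<open>G/D\<close> is the invariant that takes finitely many values. It determines the
  action on \<open>G/M\<close> because \<open>D \<subseteq> M\<close>.\<close>

lemma (in group) finite_index_trivial_action:
  assumes D: "D \<lhd> G" and ab: "comm_group (G Mod D)" and M: "M \<lhd> G" and DM: "D \<subseteq> M"
    and fin: "finite (carrier (G Mod D)) \<or> non_periodic (G Mod D)"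
  shows "finite (rcosets\<^bsub>NormalAutoGroup G\<^esub> (trivial_action G (carrier G) M))"
proof -
  interpret A: group "NormalAutoGroup G" by (rule group_NormalAutoGroup)
  interpret D: normal D G by (rule D)
  interpret M: normal M G by (rule M)
  let ?Q = "carrier (G Mod D)"
  define f where "f \<phi> = restrict ((`) \<phi>) ?Q" for \<phi> :: "'a \<Rightarrow> 'a"
  show ?thesis
  proof (rule A.finite_rcosets_if_finite_invariant)
    show "subgroup (trivial_action G (carrier G) M) (NormalAutoGroup G)"
      by (rule normal_imp_subgroup[OF trivial_action_normal[OF normal_self M]])
    show "finite (f ` carrier (NormalAutoGroup G))"
      using fin
    proof
      assume Q: "finite ?Q"
      have "f ` normal_autos G \<subseteq> ?Q \<rightarrow>\<^sub>E ?Q"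
        using normal_autos_mem[OF _ normal_self]
        by (auto simp: f_def carrier_FactGroup normal_autos_image_rcos[OF _ D])
      then show ?thesis using finite_PiE[OF Q, of "\<lambda>_. ?Q"] Q by (simp add: finite_subset)
    next
      assume np: "non_periodic (G Mod D)"
      have "f \<phi> \<in> {\<lambda>C\<in>?Q. C, \<lambda>C\<in>?Q. inv\<^bsub>G Mod D\<^esub> C}" if "\<phi> \<in> normal_autos G" for \<phi>
        using normal_autos_on_abelian_quotient[OF D ab np that]
        unfolding f_def by (auto intro!: restrict_ext)
      then show ?thesis by (auto intro: finite_subset[of _ "{\<lambda>C\<in>?Q. C, \<lambda>C\<in>?Q. inv\<^bsub>G Mod D\<^esub> C}"])
    qed
    fix \<phi> \<psi> assume "\<phi> \<in> carrier (NormalAutoGroup G)" "\<psi> \<in> carrier (NormalAutoGroup G)"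
      and eq: "f \<phi> = f \<psi>"
    then have p: "\<phi> \<in> normal_autos G" and q: "\<psi> \<in> normal_autos G" by simp_all
    let ?j = "inv\<^bsub>NormalAutoGroup G\<^esub> \<psi>"
    have j: "?j \<in> normal_autos G" by (rule NormalAutoGroup_inv_closed[OF q])
    have eqD: "D #> \<phi> h = D #> \<psi> h" if "h \<in> carrier G" for h
      using fun_cong[OF eq, of "D #> h"] that normal_autos_image_rcos[OF p D that]
        normal_autos_image_rcos[OF q D that] by (simp add: f_def carrier_FactGroup)
    have eqM: "M #> \<phi> (?j g) = M #> g" if g: "g \<in> carrier G" for g
    proof -
      have jg: "?j g \<in> carrier G" by (rule normal_autos_mem[OF j normal_self g])
      have pjg: "\<phi> (?j g) \<in> carrier G" by (rule normal_autos_mem[OF p normal_self jg])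
      have "D #> \<phi> (?j g) = D #> g"
        using eqD[OF jg] NormalAutoGroup_inv_apply(1)[OF q g] by simp
      then have "\<phi> (?j g) \<in> D #> g" using rcos_self[OF pjg D.subgroup_axioms] by simp
      then have "\<phi> (?j g) \<in> M #> g" using DM by (auto simp: r_coset_def)
      then show ?thesis using repr_independence[OF _ g M.subgroup_axioms] by simp
    qed
    then show "\<phi> \<otimes>\<^bsub>NormalAutoGroup G\<^esub> ?j \<in> trivial_action G (carrier G) M"
      using A.m_closed[of \<phi> ?j] p j by (simp add: trivial_action_def NormalAutoGroup_mult_apply)
  qed
qed

lemma (in comm_group) finite_generate_if_periodic:
  assumes "finite S" "S \<subseteq> carrier G" "\<And>x. x \<in> S \<Longrightarrow> ord x \<noteq> 0"
  shows "finite (generate G S)"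
  using assms
proof (induction S)
  case empty
  show ?case by (simp add: generate_empty)
next
  case (insert s S)
  have s: "s \<in> carrier G" and S: "S \<subseteq> carrier G" using insert.prems by auto
  interpret C: subgroup "generate G {s}" G using s by (intro generate_is_subgroup) auto
  interpret H: subgroup "generate G S" G using S by (intro generate_is_subgroup)
  have "finite (generate G {s})"
    using finite_cyclic_subgroup_order[OF s] insert.prems(2)[of s] s
    by (simp add: carrier_subgroup_generated)
  then have fin: "finite (generate G {s} <#> generate G S)"
    using insert by (simp add: set_mult_def)
  have "generate G (insert s S) \<subseteq> generate G {s} <#> generate G S"
  proof (rule generate_subgroup_incl)
    show "subgroup (generate G {s} <#> generate G S) G"
      by (rule mult_subgroups[OF C.subgroup_axioms H.subgroup_axioms])
    have "s = s \<otimes> \<one>" using s by simp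
    moreover have "x = \<one> \<otimes> x" if "x \<in> S" for x using S that by auto
    ultimately show "insert s S \<subseteq> generate G {s} <#> generate G S"
      unfolding set_mult_def using generate.incl[of _ S G] generate.incl[of s "{s}" G] C.one_closed H.one_closed
      by blast
  qed
  then show ?case using fin by (rule finite_subset)
qed

lemma (in group) finitely_generated_abelianization:
  assumes "finitely_generated_group G" and periodic: "\<not> non_periodic (abelianization G)"
  shows "finite (carrier (abelianization G))"
proof -
  let ?D = "derived G (carrier G)"
  interpret D: normal ?D G by (rule derived_self_is_normal)
  interpret Q: comm_group "abelianization G"
    unfolding abelianization_def by (rule derived_quot_is_comm_group)
  interpret p: group_hom G "abelianization G" "\<lambda>a. ?D #> a"
    unfolding abelianization_def by (rule D.r_coset_group_hom)
  obtain S where S: "finite S" "S \<subseteq> carrier G" "generate G S = carrier G"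
    using assms(1) by (auto simp: finitely_generated_group_def)
  have "generate (abelianization G) ((\<lambda>a. ?D #> a) ` S) = carrier (abelianization G)"
    using p.generate_img[OF S(2)] S(3) by (simp add: abelianization_def carrier_FactGroup)
  moreover have "(\<lambda>a. ?D #> a) ` S \<subseteq> carrier (abelianization G)"
    using S(2) by auto
  ultimately show ?thesis
    using Q.finite_generate_if_periodic[of "(\<lambda>a. ?D #> a) ` S"] S(1) periodic
    unfolding non_periodic_def by (metis finite_imageI subsetD)
qed

section \<open>Normal automorphisms of nilpotent-by-abelian groups\<close>

theorem theorem2:
  fixes G :: "'a monoid" and c :: nat
  assumes "group G"
    and "group_by_group (nilpotent_of_class c) comm_group G"
  shows "(finite (carrier (abelianization G))
            \<or> (infinite (carrier (abelianization G)) \<and> non_periodic (abelianization G))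
          \<longrightarrow> virtually (group_by_group (nilpotent_of_class_le c) comm_group) (NormalAutoGroup G))
       \<and> (finitely_generated_group G
          \<longrightarrow> finite (carrier (abelianization G))
            \<or> (infinite (carrier (abelianization G)) \<and> non_periodic (abelianization G)))"
proof (intro conjI impI)
  interpret group G by (rule assms(1))
  let ?D = "derived G (carrier G)"
  obtain M where M: "M \<lhd> G" "nilpotent_of_class c (G\<lparr>carrier := M\<rparr>)" "comm_group (G Mod M)"
    using assms(2) by (auto simp: group_by_group_def)
  let ?L = "\<lambda>j. case j of 0 \<Rightarrow> carrier G | Suc i \<Rightarrow> lower_central (G\<lparr>carrier := M\<rparr>) i"
  interpret L: abelian_by_central_series G ?L
    by (rule abelian_by_lower_central_series[OF M(1,3)])
  have "lower_central (G\<lparr>carrier := M\<rparr>) c = {\<one>\<^bsub>G\<^esub>}"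
    using M(2) LeastI_ex[of "\<lambda>n. lower_central (G\<lparr>carrier := M\<rparr>) n = {\<one>\<^bsub>G\<^esub>}"]
    by (auto simp: nilpotent_of_class_def nilpotent_group_def nilpotency_class_def)
  then have nil: "group_by_group (nilpotent_of_class_le c) comm_group
      (NormalAutoGroup G\<lparr>carrier := trivial_action G (carrier G) M\<rparr>)"
    using L.trivial_action_nilpotent_by_abelian[of c] by simp
  assume "finite (carrier (abelianization G))
    \<or> (infinite (carrier (abelianization G)) \<and> non_periodic (abelianization G))"
  then have "finite (rcosets\<^bsub>NormalAutoGroup G\<^esub> (trivial_action G (carrier G) M))"
    by (intro finite_index_trivial_action[OF derived_self_is_normal derived_quot_is_comm_group M(1)
          derived_minimal[OF M(1,3)]]) (auto simp: abelianization_def)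
  then show "virtually (group_by_group (nilpotent_of_class_le c) comm_group) (NormalAutoGroup G)"
    unfolding virtually_def
    using nil normal_imp_subgroup[OF trivial_action_normal[OF normal_self M(1)]] by blast
next
  assume "finitely_generated_group G"
  then show "finite (carrier (abelianization G))
    \<or> (infinite (carrier (abelianization G)) \<and> non_periodic (abelianization G))"
    using group.finitely_generated_abelianization[OF assms(1)] by blast
qed

end
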